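(* If $\mathbb{H}_0(\Omega)\cup\mathbb{H}_1(\Omega)\subset\Omega$, then the bipartite graph $\Gamma(\Omega,q)$ is edge-transitive, or equivalently, for any pair of adjacent vertices $[l]\in L(\Omega)$ and $\langle r\rangle\in R(\Omega)$ there is an automorphism $\pi$ of $\Gamma(\Omega,q)$ such that $\pi([l])=[0]_0$ and $\pi(\langle r\rangle)=\langle 0\rangle_0$.
   Context: Let $q$ be a prime power and $\mathbb{F}_q$ the field with $q$ elements. $\{0,1\}^*$ is the set of finite binary sequences, $\eta$ the null sequence; juxtaposition is concatenation. $\Omega\subset\{0,1\}^*$ is a finite set satisfying condition C1: $\eta\in\Omega$, and for any $\alpha\in\Omega\setminus\{\eta\}$ the sequence obtained by deleting the last bit of $\alpha$ is in $\Omega$. $L(\Omega)$ and $R(\Omega)$ are two disjoint copies of $\mathbb{F}_q^{|\Omega|+1}$; their vectors are written $[l]$ and $\langle r\rangle$ respectively, with entries indexed by $\Omega\cup\{*\}$, where $*\notin\Omega$ is an extra symbol. $[0]_0\in L(\Omega)$ and $\langle 0\rangle_0\in R(\Omega)$ are the all-zero vectors. $\Gamma(\Omega,q)$ is the bipartite graph with vertex set $L(\Omega)\cup R(\Omega)$ in which $[l]\in L(\Omega)$ and $\langle r\rangle\in R(\Omega)$ are adjacent if and only if $l_\eta+r_\eta=l_*r_*$, $l_{\alpha0}+r_{\alpha0}=r_*l_\alpha$ for all $\alpha0\in\Omega$, and $l_{\beta1}+r_{\beta1}=l_*r_\beta$ for all $\beta1\in\Omega$ (here $\alpha,\beta\in\{0,1\}^*$).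 For $a\in\{0,1\}$, $\mathbb{H}_a(\Omega)$ is the set of all binary sequences obtained from sequences in $\Omega$ by a finite number (possibly zero) of iterated deletions, each of which deletes a symbol $a$ either from the first position (when the first bit is $a$) or from two consecutive $a$'s (replacing some block $aa$ by $a$). *)

theory Defs
  imports "HOL-Library.FuncSet"
begin

record 'v ugraph =
  vertices :: "'v set"
  edges :: "'v set set"

definition automorphism :: "'v ugraph \<Rightarrow> ('v \<Rightarrow> 'v) \<Rightarrow> bool" where
  "automorphism G \<pi> \<longleftrightarrow>
     bij_betw \<pi> (vertices G) (vertices G) \<and>
     (\<forall>u\<in>vertices G. \<forall>v\<in>vertices G. {\<pi> u, \<pi> v} \<in> edges G \<longleftrightarrow> {u, v} \<in> edges G)"

definition edge_transitive :: "'v ugraph \<Rightarrow> bool" where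
  "edge_transitive G \<longleftrightarrow>
     (\<forall>e\<in>edges G. \<forall>e'\<in>edges G. \<exists>\<pi>. automorphism G \<pi> \<and> \<pi> ` e = e')"

text \<open>Binary words are lists of booleans, first bit at the head: the bit 0 is \<^term>\<open>False\<close>,
  the bit 1 is \<^term>\<open>True\<close>, and the null sequence is \<^term>\<open>[]\<close>.\<close>

type_synonym word = "bool list"

definition condition_C1 :: "word set \<Rightarrow> bool" where
  "condition_C1 \<Omega> \<longleftrightarrow> [] \<in> \<Omega> \<and> (\<forall>\<alpha>\<in>\<Omega> - {[]}. butlast \<alpha> \<in> \<Omega>)"

inductive deletion :: "bool \<Rightarrow> word \<Rightarrow> word \<Rightarrow> bool" for a :: bool where
  first: "deletion a (a # w) w"
| double: "deletion a (u @ [a, a] @ v) (u @ [a] @ v)"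

definition HH :: "bool \<Rightarrow> word set \<Rightarrow> word set" where
  "HH a \<Omega> = {w. \<exists>\<alpha>\<in>\<Omega>. (deletion a)\<^sup>*\<^sup>* \<alpha> w}"

text \<open>The extra index \<open>*\<close> is \<^term>\<open>None\<close>, and a word \<open>\<alpha>\<close> is the index \<open>Some \<alpha>\<close>.  Vectors are
  extensional functions (\<^term>\<open>undefined\<close> off the index set), so that they are determined by their
  entries on the index set.\<close>

definition index_set :: "word set \<Rightarrow> word option set" where
  "index_set \<Omega> = insert None (Some ` \<Omega>)"

type_synonym 'f vec = "word option \<Rightarrow> 'f"

definition vecs :: "word set \<Rightarrow> 'f vec set" where
  "vecs \<Omega> = extensional (index_set \<Omega>)"

definition zero_vec :: "word set \<Rightarrow> 'f::zero vec" where
  "zero_vec \<Omega> = (\<lambda>i\<in>index_set \<Omega>. 0)"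

datatype 'f vertex = LV "'f vec" | RV "'f vec"

definition incident :: "word set \<Rightarrow> 'f::field vec \<Rightarrow> 'f vec \<Rightarrow> bool" where
  "incident \<Omega> l r \<longleftrightarrow>
     l (Some []) + r (Some []) = l None * r None \<and>
     (\<forall>\<alpha>. \<alpha> @ [False] \<in> \<Omega> \<longrightarrow>
        l (Some (\<alpha> @ [False])) + r (Some (\<alpha> @ [False])) = r None * l (Some \<alpha>)) \<and>
     (\<forall>\<beta>. \<beta> @ [True] \<in> \<Omega> \<longrightarrow>
        l (Some (\<beta> @ [True])) + r (Some (\<beta> @ [True])) = l None * r (Some \<beta>))"

definition Gamma :: "word set \<Rightarrow> 'f::{field,finite} vertex ugraph" where
  "Gamma \<Omega> = \<lparr>vertices = LV ` vecs \<Omega> \<union> RV ` vecs \<Omega>,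
              edges = {{LV l, RV r} | l r. l \<in> vecs \<Omega> \<and> r \<in> vecs \<Omega> \<and> incident \<Omega> l r}\<rparr>"

end

theory Submission
  imports Defs
begin

text \<open>
  Every edge is carried to the zero edge by composing automorphisms of two kinds.  Write \<open>x\<close> and
  \<open>y\<close> for the entries of \<open>l\<close> and \<open>r\<close> at the extra index.

  Translations replace \<open>x\<close> by \<open>x + s\<close> and keep \<open>y\<close>.  The equations then dictate the other entries.
  At the null sequence the extra term \<open>s y\<close> is put into \<open>r\<close>.  Appending the bit 0
  multiplies the new entry of \<open>l\<close> by \<open>y\<close>, and \<open>y l_v = l_{v0} + r_{v0}\<close> splits back into a function
  of \<open>l\<close> and a function of \<open>r\<close>.  Appending the bit 1 multiplies the new entry of \<open>r\<close> by \<open>x + s\<close>;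
  the part with \<open>x\<close> splits in the same way and the part with \<open>s\<close> is already a function of \<open>r\<close>.  So
  each new entry is a linear combination of old entries of the same vector (\<open>transl\<close>).  The words in
  the combination for \<open>l_w\<close> arise from \<open>w\<close> by deleting an initial 1 or shortening a block 11, and
  those for \<open>r_w\<close> are governed in the same way by \<open>w1\<close> (\<open>transl_cong\<close>); this is where closure
  of \<open>\<Omega>\<close> under such deletions is needed.  Exchanging the two sides and the two bits gives
  the translations of \<open>y\<close>.

  Shifts at a word \<open>\<gamma>\<close> add \<open>t\<close> to \<open>l_\<gamma>\<close> and \<open>-t\<close> to \<open>r_\<gamma>\<close>.  Then \<open>r_{\<gamma>0}\<close> has to gain \<open>t y\<close>, and
  \<open>l_{\<gamma>01}\<close>, \<open>r_{\<gamma>01}\<close> together have to gain \<open>t x y\<close>, which is \<open>t l_\<eta> + t r_\<eta>\<close>.  From there on the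
  correction at \<open>\<gamma>01u\<close> is \<open>t\<close> times the entry at \<open>u\<close>, because the correction satisfies the
  equations of the graph read at \<open>u\<close>.  The branch \<open>\<gamma>10u\<close> is the mirror image.  The words \<open>u\<close> lie in
  \<open>\<Omega>\<close> since deleting the first bit, whichever it is, stays in \<open>\<Omega>\<close> (\<open>coupled_shift\<close>).

  Both maps change an entry only by something that depends on entries at the extra index or at
  shorter words.  They are therefore injective, and since the graph is finite, an injective map
  that preserves incidence is an automorphism (\<open>automorphism_side_map\<close>).  Two translations bring an
  edge to \<open>x = y = 0\<close>.  A shift at \<open>\<gamma>\<close> changes only entries at words that begin with \<open>\<gamma>\<close>, so shifts
  at the words of \<open>\<Omega>\<close> in order of length kill all entries of \<open>l\<close>, and incidence forces \<open>r = 0\<close>.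
\<close>

section \<open>Automorphisms from triangular maps\<close>

definition carries :: "word set \<Rightarrow> 'f::{field,finite} vec \<times> 'f vec \<Rightarrow> 'f vec \<times> 'f vec \<Rightarrow> bool" where
  "carries \<Omega> e e' \<longleftrightarrow> (\<exists>\<pi>. automorphism (Gamma \<Omega>) \<pi> \<and>
     \<pi> (LV (fst e)) = LV (fst e') \<and> \<pi> (RV (snd e)) = RV (snd e'))"

definition arcs :: "word set \<Rightarrow> ('f::field vec \<times> 'f vec) set" where
  "arcs \<Omega> = {(l, r). l \<in> vecs \<Omega> \<and> r \<in> vecs \<Omega> \<and> incident \<Omega> l r}"

lemma edge_iff_arc: "{LV l, RV r} \<in> edges (Gamma \<Omega>) \<longleftrightarrow> (l, r) \<in> arcs \<Omega>"
  by (auto simp: Gamma_def arcs_def doubleton_eq_iff)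

lemma edges_eq_arcs: "edges (Gamma \<Omega>) = (\<lambda>(l, r). {LV l, RV r}) ` arcs \<Omega>"
  by (auto simp: Gamma_def arcs_def image_iff)

lemma not_edge: "{LV l, LV l'} \<notin> edges (Gamma \<Omega>)" "{RV r, RV r'} \<notin> edges (Gamma \<Omega>)"
  by (auto simp: Gamma_def doubleton_eq_iff)

lemma finite_vecs:
  assumes "finite \<Omega>"
  shows "finite (vecs \<Omega> :: 'f::finite vec set)"
proof -
  have "vecs \<Omega> = (index_set \<Omega> \<rightarrow>\<^sub>E (UNIV :: 'f set))"
    by (auto simp: vecs_def PiE_def)
  then show ?thesis
    using assms by (auto simp: index_set_def intro: finite_PiE)
qed

fun side_map :: "('f vec \<Rightarrow> 'f vec) \<Rightarrow> ('f vec \<Rightarrow> 'f vec) \<Rightarrow> 'f vertex \<Rightarrow> 'f vertex" where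
  "side_map \<Phi> \<Psi> (LV l) = LV (\<Phi> l)"
| "side_map \<Phi> \<Psi> (RV r) = RV (\<Psi> r)"

text \<open>Only one direction of the equivalence for edges is assumed: the map induced on the finite set
  of arcs is injective, hence onto, so that no non-edge can become an edge.\<close>

lemma automorphism_side_map:
  fixes \<Phi> \<Psi> :: "'f::{field,finite} vec \<Rightarrow> 'f vec"
  assumes fin: "finite \<Omega>"
    and \<Phi>: "inj_on \<Phi> (vecs \<Omega>)" "\<Phi> ` vecs \<Omega> \<subseteq> vecs \<Omega>"
    and \<Psi>: "inj_on \<Psi> (vecs \<Omega>)" "\<Psi> ` vecs \<Omega> \<subseteq> vecs \<Omega>"
    and inc: "\<And>l r. incident \<Omega> l r \<Longrightarrow> incident \<Omega> (\<Phi> l) (\<Psi> r)"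
  shows "automorphism (Gamma \<Omega>) (side_map \<Phi> \<Psi>)"
proof -
  note fv = finite_vecs[OF fin, where 'f = 'f]
  have surj: "\<Phi> ` vecs \<Omega> = vecs \<Omega>" "\<Psi> ` vecs \<Omega> = vecs \<Omega>"
    using endo_inj_surj[OF fv] \<Phi> \<Psi> by auto
  have arcs_sub: "arcs \<Omega> \<subseteq> vecs \<Omega> \<times> vecs \<Omega>"
    by (auto simp: arcs_def)
  have finarcs: "finite (arcs \<Omega> :: ('f vec \<times> 'f vec) set)"
    using finite_subset[OF arcs_sub] fv by blast
  have injp: "inj_on (map_prod \<Phi> \<Psi>) (vecs \<Omega> \<times> vecs \<Omega>)"
    using \<Phi>(1) \<Psi>(1) by (auto simp: inj_on_def)
  have "map_prod \<Phi> \<Psi> ` arcs \<Omega> \<subseteq> arcs \<Omega>"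
    using \<Phi>(2) \<Psi>(2) inc by (auto simp: arcs_def)
  then have arcs_onto: "map_prod \<Phi> \<Psi> ` arcs \<Omega> = arcs \<Omega>"
    using endo_inj_surj[OF finarcs] inj_on_subset[OF injp arcs_sub] by blast
  have iff: "(\<Phi> l, \<Psi> r) \<in> arcs \<Omega> \<longleftrightarrow> (l, r) \<in> arcs \<Omega>" if "l \<in> vecs \<Omega>" "r \<in> vecs \<Omega>" for l r
    using inj_on_image_mem_iff[OF injp, of "(l, r)" "arcs \<Omega>"] arcs_sub that arcs_onto by auto
  have inj: "inj_on (side_map \<Phi> \<Psi>) (LV ` vecs \<Omega> \<union> RV ` vecs \<Omega>)"
    by (rule inj_onI, elim UnE imageE) (auto dest: inj_onD[OF \<Phi>(1)] inj_onD[OF \<Psi>(1)])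
  have im: "side_map \<Phi> \<Psi> ` (LV ` vecs \<Omega> \<union> RV ` vecs \<Omega>) = LV ` vecs \<Omega> \<union> RV ` vecs \<Omega>"
  proof -
    have "side_map \<Phi> \<Psi> ` LV ` vecs \<Omega> = LV ` \<Phi> ` vecs \<Omega>"
      "side_map \<Phi> \<Psi> ` RV ` vecs \<Omega> = RV ` \<Psi> ` vecs \<Omega>"
      by (simp_all add: image_image)
    then show ?thesis
      by (simp only: image_Un surj)
  qed
  have "{side_map \<Phi> \<Psi> u, side_map \<Phi> \<Psi> v} \<in> edges (Gamma \<Omega>) \<longleftrightarrow> {u, v} \<in> edges (Gamma \<Omega>)"
    if "u \<in> LV ` vecs \<Omega> \<union> RV ` vecs \<Omega>" "v \<in> LV ` vecs \<Omega> \<union> RV ` vecs \<Omega>" for u v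
  proof -
    have RL: "{RV r, LV l} = {LV l, RV r}" for l r :: "'f vec"
      by (rule insert_commute)
    show ?thesis
      using that iff by (elim UnE imageE) (simp_all add: RL edge_iff_arc not_edge)
  qed
  then show ?thesis
    using inj im by (auto simp: automorphism_def bij_betw_def Gamma_def)
qed

lemma carries_trans:
  assumes "carries \<Omega> e e'" "carries \<Omega> e' e''"
  shows "carries \<Omega> e e''"
proof -
  obtain \<pi> \<sigma> where \<pi>: "automorphism (Gamma \<Omega>) \<pi>" "\<pi> (LV (fst e)) = LV (fst e')"
      "\<pi> (RV (snd e)) = RV (snd e')"
    and \<sigma>: "automorphism (Gamma \<Omega>) \<sigma>" "\<sigma> (LV (fst e')) = LV (fst e'')"
      "\<sigma> (RV (snd e')) = RV (snd e'')"
    using assms unfolding carries_def by blast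
  have "automorphism (Gamma \<Omega>) (\<sigma> \<circ> \<pi>)"
    using \<pi>(1) \<sigma>(1) unfolding automorphism_def
    by (auto intro: bij_betw_trans dest: bij_betwE)
  then show ?thesis
    using \<pi> \<sigma> unfolding carries_def by (intro exI[of _ "\<sigma> \<circ> \<pi>"]) simp
qed

lemma carries_refl: "carries \<Omega> e e"
  unfolding carries_def automorphism_def by (intro exI[of _ id]) auto

lemma automorphism_inv:
  assumes "automorphism G \<pi>"
  shows "automorphism G (inv_into (vertices G) \<pi>)"
proof -
  have bij: "bij_betw \<pi> (vertices G) (vertices G)"
    and e: "\<And>u v. u \<in> vertices G \<Longrightarrow> v \<in> vertices G \<Longrightarrow>
              {\<pi> u, \<pi> v} \<in> edges G \<longleftrightarrow> {u, v} \<in> edges G"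
    using assms by (auto simp: automorphism_def)
  have "bij_betw (inv_into (vertices G) \<pi>) (vertices G) (vertices G)"
    using bij by (rule bij_betw_inv_into)
  with bij show ?thesis
    unfolding automorphism_def
    by (auto simp: bij_betw_inv_into_right bij_betw_apply simp flip: e)
qed

lemma carries_sym:
  assumes "carries \<Omega> e e'" "e \<in> arcs \<Omega>"
  shows "carries \<Omega> e' e"
proof -
  obtain \<pi> where \<pi>: "automorphism (Gamma \<Omega>) \<pi>" "\<pi> (LV (fst e)) = LV (fst e')"
      "\<pi> (RV (snd e)) = RV (snd e')"
    using assms unfolding carries_def by blast
  have v: "LV (fst e) \<in> vertices (Gamma \<Omega>)" "RV (snd e) \<in> vertices (Gamma \<Omega>)"
    using assms(2) by (auto simp: arcs_def Gamma_def)
  have "inj_on \<pi> (vertices (Gamma \<Omega>))"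
    using \<pi>(1) by (auto simp: automorphism_def bij_betw_def)
  then show ?thesis
    unfolding carries_def using automorphism_inv[OF \<pi>(1)] \<pi>(2,3) v
    by (metis inv_into_f_f)
qed

lemma edge_transitiveI:
  fixes e0 :: "'f::{field,finite} vec \<times> 'f vec"
  assumes "\<And>e. e \<in> arcs \<Omega> \<Longrightarrow> carries \<Omega> e e0"
  shows "edge_transitive (Gamma \<Omega> :: 'f vertex ugraph)"
  unfolding edge_transitive_def
proof (intro ballI)
  fix E E' :: "'f vertex set"
  assume "E \<in> edges (Gamma \<Omega>)" "E' \<in> edges (Gamma \<Omega>)"
  then obtain e e' where e: "e \<in> arcs \<Omega>" "E = {LV (fst e), RV (snd e)}"
    and e': "e' \<in> arcs \<Omega>" "E' = {LV (fst e'), RV (snd e')}"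
    by (fastforce simp: edges_eq_arcs)
  have "carries \<Omega> e e'"
    using carries_trans carries_sym assms e(1) e'(1) by blast
  then show "\<exists>\<pi>. automorphism (Gamma \<Omega>) \<pi> \<and> \<pi> ` E = E'"
    unfolding carries_def e(2) e'(2) by auto
qed

fun rank :: "word option \<Rightarrow> nat" where
  "rank None = 0"
| "rank (Some w) = Suc (length w)"

definition on_indices :: "word set \<Rightarrow> ('f vec \<Rightarrow> 'f vec) \<Rightarrow> 'f vec \<Rightarrow> 'f vec" where
  "on_indices \<Omega> F p = restrict (F p) (index_set \<Omega>)"

lemma on_indices_apply [simp]:
  "on_indices \<Omega> F p None = F p None"
  "w \<in> \<Omega> \<Longrightarrow> on_indices \<Omega> F p (Some w) = F p (Some w)"
  by (auto simp: on_indices_def index_set_def)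

lemma on_indices_vecs: "on_indices \<Omega> F p \<in> vecs \<Omega>"
  by (simp add: on_indices_def vecs_def)

text \<open>Each entry is determined by its new value and the entries of smaller rank, so a triangular map
  is undone entry by entry, first at the extra index and then at words of increasing length.\<close>

definition triangular :: "('f vec \<Rightarrow> 'f vec) \<Rightarrow> bool" where
  "triangular F \<longleftrightarrow> (\<forall>p q i. F p i = F q i \<longrightarrow> (\<forall>j. rank j < rank i \<longrightarrow> p j = q j) \<longrightarrow> p i = q i)"

lemma inj_on_triangular:
  assumes "triangular F"
  shows "inj_on (on_indices \<Omega> F) (vecs \<Omega>)"
proof (rule inj_onI)
  fix p q
  assume pq: "p \<in> vecs \<Omega>" "q \<in> vecs \<Omega>" "on_indices \<Omega> F p = on_indices \<Omega> F q"
  have "p i = q i" for i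
  proof (induction i rule: measure_induct_rule[of rank])
    case (less i)
    show ?case
    proof (cases "i \<in> index_set \<Omega>")
      case True
      then have "F p i = F q i"
        using fun_cong[OF pq(3), of i] by (simp add: on_indices_def)
      then show ?thesis
        using assms less by (auto simp: triangular_def)
    next
      case False
      then show ?thesis
        using pq(1,2) by (auto simp: vecs_def extensional_def)
    qed
  qed
  then show "p = q" by blast
qed

text \<open>The incidence relation seen from one side.  Here \<open>a\<close> is the bit whose equations are multiplied
  by the extra entry of the first vector, so the relation for \<open>a\<close> and the relation for the other
  bit with the vectors exchanged agree.  Translations and shifts are constructed once, for a general
  \<open>a\<close>, and serve both sides of the graph.\<close>

definition coupled :: "bool \<Rightarrow> word set \<Rightarrow> 'f::field vec \<Rightarrow> 'f vec \<Rightarrow> bool" where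
  "coupled a \<Omega> p q \<longleftrightarrow>
     p (Some []) + q (Some []) = p None * q None \<and>
     (\<forall>w. w @ [\<not> a] \<in> \<Omega> \<longrightarrow>
        p (Some (w @ [\<not> a])) + q (Some (w @ [\<not> a])) = q None * p (Some w)) \<and>
     (\<forall>w. w @ [a] \<in> \<Omega> \<longrightarrow> p (Some (w @ [a])) + q (Some (w @ [a])) = p None * q (Some w))"

lemma incident_coupled: "incident \<Omega> l r \<longleftrightarrow> coupled True \<Omega> l r"
  by (simp add: incident_def coupled_def)

lemma coupled_swap: "coupled (\<not> a) \<Omega> q p \<longleftrightarrow> coupled a \<Omega> p q"
  by (auto simp: coupled_def add.commute mult.commute)

lemma carries_triangular:
  fixes F G :: "'f::{field,finite} vec \<Rightarrow> 'f vec"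
  assumes "finite \<Omega>"
    and tri: "triangular F" "triangular G"
    and inc: "\<And>l r. coupled True \<Omega> l r \<Longrightarrow> coupled True \<Omega> (on_indices \<Omega> F l) (on_indices \<Omega> G r)"
    and arc: "(l, r) \<in> arcs \<Omega>"
  shows "carries \<Omega> (l, r) (on_indices \<Omega> F l, on_indices \<Omega> G r)"
    and "(on_indices \<Omega> F l, on_indices \<Omega> G r) \<in> arcs \<Omega>"
proof -
  have "automorphism (Gamma \<Omega>) (side_map (on_indices \<Omega> F) (on_indices \<Omega> G))"
  proof (rule automorphism_side_map[OF assms(1)])
    show "inj_on (on_indices \<Omega> F) (vecs \<Omega>)" "inj_on (on_indices \<Omega> G) (vecs \<Omega>)"
      using tri by (simp_all add: inj_on_triangular)
  qed (auto simp: incident_coupled on_indices_vecs inc)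
  then show "carries \<Omega> (l, r) (on_indices \<Omega> F l, on_indices \<Omega> G r)"
    unfolding carries_def by (intro exI[of _ "side_map (on_indices \<Omega> F) (on_indices \<Omega> G)"]) simp
  show "(on_indices \<Omega> F l, on_indices \<Omega> G r) \<in> arcs \<Omega>"
    using arc inc by (auto simp: arcs_def incident_coupled on_indices_vecs)
qed

section \<open>Translating the entry at the extra index\<close>

text \<open>With the convention that appending the distinguished bit to the extra index gives the null
  sequence, the equation \<open>p_\<eta> + q_\<eta> = p_* q_*\<close> becomes an instance of
  \<open>p_{va} + q_{va} = p_* q_v\<close>.  For the other bit the value at the extra index is
  a default.\<close>

fun ext :: "bool \<Rightarrow> word option \<Rightarrow> word" where
  "ext b None = []"
| "ext b (Some v) = v @ [b]"

text \<open>The linear functional that gives the new entry at a word (here read backwards) when \<open>p_*\<close> is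
  replaced by \<open>p_* + s\<close>.  The flag \<open>k\<close> selects the vector: false for \<open>p\<close>, true for \<open>q\<close>.  If the last bit
  is \<open>a\<close>, the new entry of \<open>q\<close> at the shortened word is multiplied by \<open>p_* + s\<close>, and otherwise the new
  entry of \<open>p\<close> is multiplied by \<open>q_*\<close>; in both cases the product with the old factor appends the bit to
  all words of the combination.  The surplus \<open>s\<close> times an entry of \<open>q\<close> is left to \<open>q\<close>.\<close>

primrec transl_rev :: "bool \<Rightarrow> 'f::field \<Rightarrow> word \<Rightarrow> bool \<Rightarrow> 'f vec \<Rightarrow> 'f" where
  "transl_rev a s [] k f = f (Some []) + (if k then s * f None else 0)"
| "transl_rev a s (b # u) k f = transl_rev a s u (b = a) (\<lambda>i. f (Some (ext b i)))
     + (if k \<and> b = a then s * transl_rev a s u True f else 0)"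

definition transl :: "bool \<Rightarrow> 'f::field \<Rightarrow> bool \<Rightarrow> word \<Rightarrow> 'f vec \<Rightarrow> 'f" where
  "transl a s k w f = transl_rev a s (rev w) k f"

lemma transl_Nil: "transl a s k [] f = f (Some []) + (if k then s * f None else 0)"
  by (simp add: transl_def)

lemma transl_snoc: "transl a s k (w @ [b]) f = transl a s (b = a) w (\<lambda>i. f (Some (ext b i)))
     + (if k \<and> b = a then s * transl a s True w f else 0)"
  by (simp add: transl_def)

lemma transl_add: "transl a s k w (\<lambda>i. f i + g i) = transl a s k w f + transl a s k w g"
  by (induction w arbitrary: k f g rule: rev_induct) (simp_all add: transl_Nil transl_snoc algebra_simps)

lemma transl_mult: "transl a s k w (\<lambda>i. c * f i) = c * transl a s k w f"
  by (induction w arbitrary: k f rule: rev_induct) (simp_all add: transl_Nil transl_snoc algebra_simps)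

text \<open>The coefficient at \<open>w\<close> itself is 1 and every other index in the combination has smaller rank.\<close>

lemma transl_triangular:
  assumes "\<And>i. rank i \<le> length w \<Longrightarrow> f i = g i"
  shows "transl a s k w f - transl a s k w g = f (Some w) - g (Some w)"
  using assms
proof (induction w arbitrary: k f g rule: rev_induct)
  case Nil
  then show ?case by (simp add: transl_Nil)
next
  case (snoc b w)
  have rank_ext: "rank (Some (ext b i)) \<le> Suc (rank i)" for i
    by (cases i) auto
  have "f (Some (ext b i)) = g (Some (ext b i))" if "rank i \<le> length w" for i
  proof (rule snoc.prems)
    show "rank (Some (ext b i)) \<le> length (w @ [b])"
      using rank_ext[of i] that by simp
  qed
  from snoc.IH[OF this] have appended: "transl a s (b = a) w (\<lambda>i. f (Some (ext b i)))
      - transl a s (b = a) w (\<lambda>i. g (Some (ext b i))) = f (Some (w @ [b])) - g (Some (w @ [b]))"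
    by simp
  have "transl a s True w f - transl a s True w g = f (Some w) - g (Some w)"
    using snoc.prems by (intro snoc.IH) auto
  then have scaled: "transl a s True w f = transl a s True w g"
    using snoc.prems[of "Some w"] by simp
  show ?case
    using appended scaled by (cases "k \<and> b = a") (auto simp: transl_snoc)
qed

abbreviation deletes :: "bool \<Rightarrow> word \<Rightarrow> word \<Rightarrow> bool" where
  "deletes a \<equiv> (deletion a)\<^sup>*\<^sup>*"

lemma deletes_append:
  assumes "deletes a w v"
  shows "deletes a (w @ x) (v @ x)"
  using assms
proof (induction rule: rtranclp_induct)
  case base
  then show ?case by simp
next
  case (step u v)
  from step.hyps(2) have "deletion a (u @ x) (v @ x)"
  proof cases
    case first
    then show ?thesis by (auto intro: deletion.first)
  next
    case (double u' v')
    then show ?thesis using deletion.double[of a u' "v' @ x"] by simp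
  qed
  with step.IH show ?case by (rule rtranclp.rtrancl_into_rtrancl)
qed

text \<open>Which old entries a new entry reads.  For \<open>q\<close> the bit \<open>a\<close> is appended on both sides of the
  deletion relation: the combination for \<open>q\<close> may lose a whole final block of \<open>a\<close>'s, which no sequence of
  deletions can do after another bit, but the loss becomes a legitimate shortening of the block once
  a further \<open>a\<close> follows.  This stronger form is also the one that the induction reproduces.\<close>

lemma transl_cong:
  shows "(\<And>v. deletes a w v \<Longrightarrow> f (Some v) = g (Some v)) \<Longrightarrow> transl a s False w f = transl a s False w g"
    and "(\<And>i. deletes a (w @ [a]) (ext a i) \<Longrightarrow> f i = g i) \<Longrightarrow> transl a s True w f = transl a s True w g"
proof (induction w arbitrary: f g rule: rev_induct)
  case Nil
  {
    case 1
    then show ?case by (simp add: transl_Nil)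
  next
    case 2
    have "deletes a [a] []"
      using deletion.first by blast
    with 2[of None] 2[of "Some []"] show ?case by (simp add: transl_Nil)
  }
next
  case (snoc b w)
  {
    case 1
    have "transl a s (b = a) w (\<lambda>i. f (Some (ext b i))) = transl a s (b = a) w (\<lambda>i. g (Some (ext b i)))"
    proof (cases "b = a")
      case True
      with 1 show ?thesis by (auto intro: snoc.IH(2))
    next
      case False
      have "f (Some (v @ [b])) = g (Some (v @ [b]))" if "deletes a w v" for v
        using 1 deletes_append[OF that] by blast
      with False show ?thesis by (auto intro: snoc.IH(1))
    qed
    then show ?case by (simp add: transl_snoc)
  next
    case 2
    have 3: "transl a s (b = a) w (\<lambda>i. f (Some (ext b i))) = transl a s (b = a) w (\<lambda>i. g (Some (ext b i)))"
    proof (cases "b = a")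
      case True
      have "f (Some (ext a i)) = g (Some (ext a i))" if "deletes a (w @ [a]) (ext a i)" for i
        using 2[of "Some (ext a i)"] deletes_append[OF that, of "[a]"] True by simp
      with True show ?thesis by (auto intro: snoc.IH(2))
    next
      case False
      have "f (Some (v @ [b])) = g (Some (v @ [b]))" if "deletes a w v" for v
        using 2[of "Some (v @ [b])"] deletes_append[OF that, of "[b, a]"] by simp
      with False show ?thesis by (auto intro: snoc.IH(1))
    qed
    have "transl a s True w f = transl a s True w g" if "b = a"
    proof (rule snoc.IH(2))
      fix i
      assume "deletes a (w @ [a]) (ext a i)"
      moreover have "deletion a (w @ [a, a]) (w @ [a])"
        using deletion.double[of a w "[]"] by simp
      ultimately show "f i = g i"
        using 2[of i] that by (simp add: converse_rtranclp_into_rtranclp)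
    qed
    with 3 show ?case by (simp add: transl_snoc)
  }
qed

definition translate :: "bool \<Rightarrow> 'f::field \<Rightarrow> bool \<Rightarrow> 'f vec \<Rightarrow> 'f vec" where
  "translate a s k p i =
     (case i of None \<Rightarrow> p None + (if k then 0 else s) | Some w \<Rightarrow> transl a s k w p)"

lemma translate_simps [simp]:
  "translate a s k p None = p None + (if k then 0 else s)"
  "translate a s k p (Some w) = transl a s k w p"
  by (simp_all add: translate_def)

lemma triangular_translate: "triangular (translate a s k)"
  unfolding triangular_def
proof (intro allI impI)
  fix p q :: "'a vec" and i
  assume assms: "translate a s k p i = translate a s k q i" "\<forall>j. rank j < rank i \<longrightarrow> p j = q j"
  show "p i = q i"
  proof (cases i)
    case None
    with assms(1) show ?thesis by simp
  next
    case (Some w)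
    with assms transl_triangular[of w p q a s k] show ?thesis by simp
  qed
qed

lemma C1_prefix: "condition_C1 \<Omega> \<Longrightarrow> w @ [b] \<in> \<Omega> \<Longrightarrow> w \<in> \<Omega>"
  unfolding condition_C1_def by (metis DiffI butlast_snoc singletonD snoc_eq_iff_butlast)

text \<open>By linearity the sum of the two new entries at \<open>wb\<close> is one functional applied to
  \<open>p_{vb} + q_{vb}\<close>.  Closure under deletions of \<open>a\<close> puts every word that is read into \<open>\<Omega>\<close>, where the
  equations of the original pair may be inserted.\<close>

lemma coupled_translate:
  assumes C1: "condition_C1 \<Omega>" and HH: "HH a \<Omega> \<subseteq> \<Omega>" and pq: "coupled a \<Omega> p q"
  shows "coupled a \<Omega> (on_indices \<Omega> (translate a s False) p) (on_indices \<Omega> (translate a s True) q)"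
proof -
  have closed: "v \<in> \<Omega>" if "deletes a w v" "w \<in> \<Omega>" for v w
    using HH that by (auto simp: HH_def)
  have Nil: "[] \<in> \<Omega>" "p (Some []) + q (Some []) = p None * q None"
    using C1 pq by (auto simp: condition_C1_def coupled_def)
  have other: "transl a s False (w @ [\<not> a]) p + transl a s True (w @ [\<not> a]) q = q None * transl a s False w p"
    if w: "w @ [\<not> a] \<in> \<Omega>" for w
  proof -
    have "transl a s False (w @ [\<not> a]) p + transl a s True (w @ [\<not> a]) q
        = transl a s False w (\<lambda>i. p (Some (ext (\<not> a) i)) + q (Some (ext (\<not> a) i)))"
      by (simp add: transl_snoc transl_add)
    also have "\<dots> = transl a s False w (\<lambda>i. q None * p i)"
    proof (rule transl_cong(1))
      fix v
      assume "deletes a w v"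
      then have "v @ [\<not> a] \<in> \<Omega>"
        using closed[OF deletes_append w] by blast
      then show "p (Some (ext (\<not> a) (Some v))) + q (Some (ext (\<not> a) (Some v)))
          = q None * p (Some v)"
        using pq by (simp add: coupled_def)
    qed
    finally show ?thesis by (simp add: transl_mult)
  qed
  have same: "transl a s False (w @ [a]) p + transl a s True (w @ [a]) q
      = (p None + s) * transl a s True w q"
    if w: "w @ [a] \<in> \<Omega>" for w
  proof -
    have "transl a s True w (\<lambda>i. p (Some (ext a i)) + q (Some (ext a i)))
        = transl a s True w (\<lambda>i. p None * q i)"
    proof (rule transl_cong(2))
      fix i
      assume "deletes a (w @ [a]) (ext a i)"
      then have "ext a i \<in> \<Omega>"
        using closed w by blast
      then show "p (Some (ext a i)) + q (Some (ext a i)) = p None * q i"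
        using pq by (cases i) (auto simp: coupled_def)
    qed
    then show ?thesis
      by (simp add: transl_snoc transl_add transl_mult algebra_simps)
  qed
  show ?thesis
    unfolding coupled_def using Nil other same C1_prefix[OF C1]
    by (auto simp: transl_Nil algebra_simps)
qed

section \<open>Shifting the entry at a word\<close>

text \<open>The correction to \<open>p\<close> at \<open>\<gamma>v\<close>, as a function of \<open>v\<close>, when \<open>t\<close> is added to \<open>p_\<gamma>\<close> and \<open>-t\<close> to \<open>q_\<gamma>\<close>.
  The correction to \<open>q\<close> is the same function with the other bit and \<open>-t\<close>.\<close>

fun bump :: "bool \<Rightarrow> 'f::field \<Rightarrow> 'f vec \<Rightarrow> word \<Rightarrow> 'f" where
  "bump a t p [] = t"
| "bump a t p [b] = (if b = a then - t * p None else 0)"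
| "bump a t p (b # c # v) =
     (if b = c then 0 else if c = a then t * p (Some v) else - t * p (Some v))"

definition shift :: "bool \<Rightarrow> word \<Rightarrow> 'f::field \<Rightarrow> 'f vec \<Rightarrow> 'f vec" where
  "shift a \<gamma> t p i = p i + (case i of None \<Rightarrow> 0
     | Some w \<Rightarrow> if take (length \<gamma>) w = \<gamma> then bump a t p (drop (length \<gamma>) w) else 0)"

lemma shift_None [simp]: "shift a \<gamma> t p None = p None"
  by (simp add: shift_def)

lemma bump_cong:
  assumes "\<And>j. rank j \<le> length v \<Longrightarrow> p j = q j"
  shows "bump a t p v = bump a t q v"
  using assms by (cases "(a, t, p, v)" rule: bump.cases) auto

lemma triangular_shift: "triangular (shift a \<gamma> t)"
  unfolding triangular_def
proof (intro allI impI)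
  fix p q :: "'a vec" and i
  assume assms: "shift a \<gamma> t p i = shift a \<gamma> t q i" "\<forall>j. rank j < rank i \<longrightarrow> p j = q j"
  show "p i = q i"
  proof (cases i)
    case None
    with assms(1) show ?thesis by (simp add: shift_def)
  next
    case (Some w)
    have "bump a t p (drop (length \<gamma>) w) = bump a t q (drop (length \<gamma>) w)"
      using assms(2) Some by (intro bump_cong) auto
    with assms(1) Some show ?thesis by (simp add: shift_def split: if_splits)
  qed
qed

text \<open>The corrections satisfy the linear equations of the graph.  For \<open>v\<close> consisting of two distinct
  bits and a word \<open>u\<close> this is \<open>t\<close> or \<open>-t\<close> times the equation of \<open>(p, q)\<close> at \<open>u\<close> extended by the same bit;
  for a single bit it is the equation at the null sequence.\<close>

lemma bump_snoc:
  assumes pq: "coupled a \<Omega> p q" and suffix: "\<forall>b w. b # w \<in> \<Omega> \<longrightarrow> w \<in> \<Omega>"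
    and v: "v @ [\<not> a] \<in> \<Omega>"
  shows "bump a t p (v @ [\<not> a]) + bump (\<not> a) (- t) q (v @ [\<not> a]) = q None * bump a t p v"
proof (cases "(a, t, p, v)" rule: bump.cases)
  case (2 _ _ _ b)
  then show ?thesis
    using pq by (auto simp: coupled_def algebra_simps simp flip: distrib_left)
next
  case (3 _ _ _ b c u)
  have "u @ [\<not> a] \<in> \<Omega>"
    using v suffix 3 by auto
  then have "p (Some (u @ [\<not> a])) + q (Some (u @ [\<not> a])) = q None * p (Some u)"
    using pq by (simp add: coupled_def)
  then have "t * p (Some (u @ [\<not> a])) + t * q (Some (u @ [\<not> a])) = q None * (t * p (Some u))"
    by (simp flip: distrib_left add: mult.left_commute)
  then show ?thesis
    using 3 by (auto simp: algebra_simps)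
qed auto

lemma shift_snoc:
  assumes pq: "coupled a \<Omega> p q" and suffix: "\<forall>b w. b # w \<in> \<Omega> \<longrightarrow> w \<in> \<Omega>"
    and w: "w @ [\<not> a] \<in> \<Omega>"
  shows "shift a \<gamma> t p (Some (w @ [\<not> a])) + shift (\<not> a) \<gamma> (- t) q (Some (w @ [\<not> a]))
    = q None * shift a \<gamma> t p (Some w)"
proof -
  have base: "p (Some (w @ [\<not> a])) + q (Some (w @ [\<not> a])) = q None * p (Some w)"
    using pq w by (simp add: coupled_def)
  have suffixes: "y \<in> \<Omega>" if "x @ y \<in> \<Omega>" for x y
    using that suffix by (induction x) auto
  \<comment> \<open>If \<open>\<gamma>\<close> is the whole word, the corrections \<open>t\<close> and \<open>-t\<close> cancel, and \<open>w\<close> is too short to be corrected.\<close>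
  consider (ext) v where "w = \<gamma> @ v" | (eq) "\<gamma> = w @ [\<not> a]"
    | (no) "take (length \<gamma>) w \<noteq> \<gamma>" "take (length \<gamma>) (w @ [\<not> a]) \<noteq> \<gamma>"
    by (metis append_take_drop_id length_append_singleton not_less_eq_eq take_all take_append
        append_Nil2 diff_is_0_eq' take_eq_Nil2)
  then show ?thesis
  proof cases
    case ext
    with w have "v @ [\<not> a] \<in> \<Omega>"
      using suffixes by simp
    note bump = bump_snoc[OF pq suffix this, of t]
    show ?thesis
      using arg_cong2[OF base bump, of "(+)"] by (simp add: shift_def ext distrib_left ac_simps)
  next
    case eq
    with base show ?thesis by (simp add: shift_def)
  next
    case no
    with base show ?thesis by (simp add: shift_def)
  qed
qed

lemma coupled_shift:
  assumes C1: "condition_C1 \<Omega>" and pq: "coupled a \<Omega> p q"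
    and suffix: "\<forall>b w. b # w \<in> \<Omega> \<longrightarrow> w \<in> \<Omega>"
  shows "coupled a \<Omega> (on_indices \<Omega> (shift a \<gamma> t) p) (on_indices \<Omega> (shift (\<not> a) \<gamma> (- t)) q)"
proof -
  have "[] \<in> \<Omega>" "p (Some []) + q (Some []) = p None * q None"
    using C1 pq by (auto simp: condition_C1_def coupled_def)
  moreover have "shift a \<gamma> t p (Some []) + shift (\<not> a) \<gamma> (- t) q (Some [])
      = p (Some []) + q (Some [])"
    by (simp add: shift_def)
  moreover note shift_snoc[OF pq suffix, where \<gamma> = \<gamma> and t = t]
  moreover have "shift a \<gamma> t p (Some (w @ [a])) + shift (\<not> a) \<gamma> (- t) q (Some (w @ [a]))
      = p None * shift (\<not> a) \<gamma> (- t) q (Some w)" if "w @ [a] \<in> \<Omega>" for w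
    using shift_snoc[of "\<not> a" \<Omega> q p w \<gamma> "- t"] pq suffix that
    by (simp only: coupled_swap not_not minus_minus add.commute)
  ultimately show ?thesis
    unfolding coupled_def using C1_prefix[OF C1] by auto
qed

section \<open>Reduction to the zero edge\<close>

lemma carries_star:
  fixes l r :: "'f::{field,finite} vec"
  assumes "finite \<Omega>" and C1: "condition_C1 \<Omega>" and HH: "HH False \<Omega> \<union> HH True \<Omega> \<subseteq> \<Omega>"
    and arc: "(l, r) \<in> arcs \<Omega>"
  obtains l' r' where "carries \<Omega> (l, r) (l', r')" "(l', r') \<in> arcs \<Omega>" "l' None = 0" "r' None = 0"
proof -
  define l1 where "l1 = on_indices \<Omega> (translate True (- l None) False) l"
  define r1 where "r1 = on_indices \<Omega> (translate True (- l None) True) r"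
  have inc1: "coupled True \<Omega> (on_indices \<Omega> (translate True s False) l)
      (on_indices \<Omega> (translate True s True) r)" if "coupled True \<Omega> l r" for l r and s :: 'f
    using coupled_translate[OF C1, of True l r s] HH that by auto
  have 1: "carries \<Omega> (l, r) (l1, r1)" "(l1, r1) \<in> arcs \<Omega>"
    unfolding l1_def r1_def
    by (rule carries_triangular[OF assms(1) triangular_translate triangular_translate _ arc],
        erule inc1)+
  have l1: "l1 None = 0"
    by (simp add: l1_def)
  \<comment> \<open>The second translation acts on the other side and keeps the entry already cleared.\<close>
  define l2 where "l2 = on_indices \<Omega> (translate False (- r1 None) True) l1"
  define r2 where "r2 = on_indices \<Omega> (translate False (- r1 None) False) r1"
  have inc2: "coupled True \<Omega> (on_indices \<Omega> (translate False s True) l)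
      (on_indices \<Omega> (translate False s False) r)" if "coupled True \<Omega> l r" for l r and s :: 'f
    using coupled_translate[OF C1, of False r l s] HH that coupled_swap[of True] by auto
  have 2: "carries \<Omega> (l1, r1) (l2, r2)" "(l2, r2) \<in> arcs \<Omega>"
    unfolding l2_def r2_def
    by (rule carries_triangular[OF assms(1) triangular_translate triangular_translate _ 1(2)],
        erule inc2)+
  show ?thesis
    using that[of l2 r2] carries_trans[OF 1(1) 2(1)] 2(2) l1 by (simp add: l2_def r2_def)
qed

text \<open>The words are treated in order of increasing length: a shift at \<open>\<gamma>\<close> affects no other word of length
  at most that of \<open>\<gamma>\<close>, so entries that have been cleared stay zero.\<close>

lemma carries_words:
  fixes l r :: "'f::{field,finite} vec"
  assumes fin: "finite \<Omega>" and C1: "condition_C1 \<Omega>" and suffix: "\<forall>b w. b # w \<in> \<Omega> \<longrightarrow> w \<in> \<Omega>"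
    and S: "finite S" "S \<subseteq> \<Omega>"
    and arc: "(l, r) \<in> arcs \<Omega>" "l None = 0" "r None = 0"
  shows "\<exists>l' r'. carries \<Omega> (l, r) (l', r') \<and> (l', r') \<in> arcs \<Omega> \<and> l' None = 0 \<and> r' None = 0 \<and>
           (\<forall>w\<in>S. l' (Some w) = 0)"
  using S
proof (induction S rule: finite_ranking_induct[where f = length])
  case empty
  then show ?case
    using arc carries_refl by blast
next
  case (insert \<gamma> S)
  then obtain l1 r1 where 1: "carries \<Omega> (l, r) (l1, r1)" "(l1, r1) \<in> arcs \<Omega>"
      "l1 None = 0" "r1 None = 0" "\<forall>w\<in>S. l1 (Some w) = 0"
    by auto
  define t where "t = - l1 (Some \<gamma>)"
  define l2 where "l2 = on_indices \<Omega> (shift True \<gamma> t) l1"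
  define r2 where "r2 = on_indices \<Omega> (shift False \<gamma> (- t)) r1"
  have inc: "coupled True \<Omega> (on_indices \<Omega> (shift True \<gamma> t) l) (on_indices \<Omega> (shift False \<gamma> (- t)) r)"
    if "coupled True \<Omega> l r" for l r
    using coupled_shift[OF C1 that suffix, where \<gamma> = \<gamma> and t = t] by simp
  have 2: "carries \<Omega> (l1, r1) (l2, r2)" "(l2, r2) \<in> arcs \<Omega>"
    unfolding l2_def r2_def
    by (rule carries_triangular[OF fin triangular_shift triangular_shift _ 1(2)],
        erule inc)+
  have "l2 (Some w) = 0" if "w \<in> insert \<gamma> S" for w
  proof -
    have "length w \<le> length \<gamma>" "w \<in> \<Omega>"
      using that insert.hyps(2) insert.prems by auto
    then show ?thesis
      using that 1(5) by (auto simp: l2_def shift_def t_def)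
  qed
  moreover have "l2 None = 0" "r2 None = 0"
    using 1 by (simp_all add: l2_def r2_def shift_def)
  ultimately show ?case
    using carries_trans[OF 1(1) 2(1)] 2(2) by blast
qed

text \<open>If \<open>l = 0\<close> and \<open>r_* = 0\<close>, the right-hand sides of all equations vanish, and with them \<open>r\<close>.\<close>

lemma zero_arcI:
  assumes arc: "(l, r) \<in> arcs \<Omega>" and "l None = 0" "r None = 0" "\<And>w. w \<in> \<Omega> \<Longrightarrow> l (Some w) = 0"
    and "[] \<in> \<Omega>"
  shows "l = zero_vec \<Omega>" "r = zero_vec \<Omega>"
proof -
  have lr: "l \<in> vecs \<Omega>" "r \<in> vecs \<Omega>" "incident \<Omega> l r"
    using arc by (auto simp: arcs_def)
  have "l i = zero_vec \<Omega> i" for i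
    using assms(2,4) lr(1) by (auto simp: zero_vec_def index_set_def vecs_def extensional_def)
  then show "l = zero_vec \<Omega>" by blast
  have "r (Some w) = 0" if "w \<in> \<Omega>" for w
  proof (cases w rule: rev_cases)
    case Nil
    then show ?thesis using lr(3) assms(2,4,5) by (auto simp: incident_def)
  next
    case (snoc u b)
    then show ?thesis
      using lr(3) assms(2-4) that unfolding incident_def by (cases b) auto
  qed
  then have "r i = zero_vec \<Omega> i" for i
    using assms(3) lr(2) by (auto simp: zero_vec_def index_set_def vecs_def extensional_def)
  then show "r = zero_vec \<Omega>" by blast
qed

lemma HH_suffix:
  assumes "HH False \<Omega> \<union> HH True \<Omega> \<subseteq> \<Omega>"
  shows "\<forall>b w. b # w \<in> \<Omega> \<longrightarrow> w \<in> \<Omega>"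
proof (intro allI impI)
  fix b w
  assume "b # w \<in> \<Omega>"
  then have "w \<in> HH b \<Omega>"
    using deletion.first unfolding HH_def by blast
  with assms show "w \<in> \<Omega>" by (cases b) auto
qed

theorem theorem3:
  fixes \<Omega> :: "word set"
  assumes "finite \<Omega>" and "condition_C1 \<Omega>"
    and "HH False \<Omega> \<union> HH True \<Omega> \<subseteq> \<Omega>"
  shows "edge_transitive (Gamma \<Omega> :: 'f::{field,finite} vertex ugraph) \<and>
         (\<forall>l r. {LV l, RV r} \<in> edges (Gamma \<Omega> :: 'f vertex ugraph) \<longrightarrow>
            (\<exists>\<pi>. automorphism (Gamma \<Omega>) \<pi> \<and>
                 \<pi> (LV l) = LV (zero_vec \<Omega>) \<and> \<pi> (RV r) = RV (zero_vec \<Omega>)))"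
proof -
  have zero: "carries \<Omega> e (zero_vec \<Omega>, zero_vec \<Omega>)"
    if arc: "e \<in> arcs \<Omega>" for e :: "'f vec \<times> 'f vec"
  proof -
    obtain l r where e: "e = (l, r)" by fastforce
    obtain l1 r1 where 1: "carries \<Omega> (l, r) (l1, r1)" "(l1, r1) \<in> arcs \<Omega>"
        "l1 None = 0" "r1 None = 0"
      by (rule carries_star[OF assms, of l r]) (use arc e in auto)
    obtain l2 r2 where 2: "carries \<Omega> (l1, r1) (l2, r2)" "(l2, r2) \<in> arcs \<Omega>"
        "l2 None = 0" "r2 None = 0" "\<forall>w\<in>\<Omega>. l2 (Some w) = 0"
      using carries_words[OF assms(1,2) HH_suffix[OF assms(3)] assms(1) subset_refl 1(2-4)] by blast
    have "l2 = zero_vec \<Omega>" "r2 = zero_vec \<Omega>"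
      using zero_arcI[OF 2(2-4)] 2(5) assms(2) by (auto simp: condition_C1_def)
    with carries_trans[OF 1(1) 2(1)] e show ?thesis by simp
  qed
  show ?thesis
    using edge_transitiveI[OF zero] zero by (auto simp: edge_iff_arc carries_def)
qed

end
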